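(* Let $\mathscr{F}$ be a nonempty family of metric spaces that is closed under dilation and Pythagorean products, i.e., if $(U,d_U),(V,d_V)\in\mathscr{F}$ and $s\in(0,\infty)$ then also $(U,s\,d_U)\in\mathscr{F}$ and $(U\oplus V)_2\in\mathscr{F}$. Fix $D\in[1,\infty)$ and $n\in\mathbb{N}$. Then an $n$-point metric space $(X,d_X)$ satisfies $$\inf_{(Y,d_Y)\in\mathscr{F}}c_Y(X)\le D$$ if and only if for every two $n$ by $n$ matrices $A,B\in M_n(\mathbb{R})$ with nonnegative entries such that every $(Z,d_Z)\in\mathscr{F}$ satisfies the $(A,B)$-quadratic metric inequality, $(X,d_X)$ satisfies the $(A,D^2B)$-quadratic metric inequality.
   Context: Metric spaces are nonempty. For metric spaces $(U,d_U),(V,d_V)$, the Pythagorean product $(U\oplus V)_2$ is $U\times V$ with the metric $d((a,b),(\alpha,\beta))=\sqrt{d_U(a,\alpha)^2+d_V(b,\beta)^2}$. For $A=(a_{ij}),B=(b_{ij})\in M_n(\mathbb{R})$ with nonnegative entries, a metric space $(X,d_X)$ satisfies the $(A,B)$-quadratic metric inequality if for every $x_1,\dots,x_n\in X$ (not necessarily distinct) $\sum_{i,j=1}^n a_{ij}d_X(x_i,x_j)^2\le\sum_{i,j=1}^n b_{ij}d_X(x_i,x_j)^2$. Distortion: a map $f:X\to Y$ has distortion at most $D\in[1,\infty]$ if there is $s\in(0,\infty)$ with $s\,d_X(x,y)\le d_Y(f(x),f(y))\le Ds\,d_X(x,y)$ for all $x,y\in X$. $c_Y(X)$ is the infimum of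 those $D$ for which some map $f:X\to Y$ has distortion at most $D$. *)

theory Defs
  imports "HOL-Analysis.Analysis"
begin

text \<open>
  Metric spaces are elements of the library type \<open>'a metric\<close>, whose carrier may be empty;
  nonemptiness has to be assumed separately. The Pythagorean product is the library's
  \<open>prod_metric\<close>, since
  \<open>prod_dist d1 d2 (a,b) (a',b') = sqrt ((d1 a a')\<^sup>2 + (d2 b b')\<^sup>2)\<close>.
\<close>

definition dilate_metric :: "real \<Rightarrow> 'a metric \<Rightarrow> 'a metric" where
  "dilate_metric s U = metric (mspace U, \<lambda>x y. s * mdist U x y)"

text \<open>For \<open>s \<le> 0\<close> the pair above need not be a metric space, hence the assumption.\<close>

lemma Metric_space_dilate:
  assumes "s > 0"
  shows "Metric_space (mspace U) (\<lambda>x y. s * mdist U x y)"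
proof
  show "0 \<le> s * mdist U x y" for x y
    using assms by simp
  show "s * mdist U x y = s * mdist U y x" for x y
    by (simp add: mdist_commute)
  show "(s * mdist U x y = 0) = (x = y)" if "x \<in> mspace U" "y \<in> mspace U" for x y
    using assms that by simp
  show "s * mdist U x z \<le> s * mdist U x y + s * mdist U y z"
    if "x \<in> mspace U" "y \<in> mspace U" "z \<in> mspace U" for x y z
    using mult_left_mono[OF mdist_triangle[OF that], of s] assms by (simp add: distrib_left)
qed

lemma mspace_dilate_metric: "s > 0 \<Longrightarrow> mspace (dilate_metric s U) = mspace U"
  by (simp add: dilate_metric_def Metric_space.mspace_metric[OF Metric_space_dilate])

lemma mdist_dilate_metric: "s > 0 \<Longrightarrow> mdist (dilate_metric s U) x y = s * mdist U x y"
  by (simp add: dilate_metric_def Metric_space.mdist_metric[OF Metric_space_dilate])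

definition isometric_metrics :: "'a metric \<Rightarrow> 'b metric \<Rightarrow> bool" where
  "isometric_metrics U V \<longleftrightarrow>
     (\<exists>f. bij_betw f (mspace U) (mspace V) \<and>
          (\<forall>x\<in>mspace U. \<forall>y\<in>mspace U. mdist V (f x) (f y) = mdist U x y))"

text \<open>
  A family of metric spaces is a set \<open>F :: 'a metric set\<close>, with \<open>'a\<close> arbitrary. The product of two
  members has carrier of type \<open>'a \<times> 'a\<close>, so it can belong to \<open>F\<close> only through an isometric copy;
  membership in \<open>F\<close> is therefore understood up to isometry in the closure conditions.
  For dilations this also disregards the values of \<open>mdist\<close> outside the carrier, which matter for
  equality in \<open>'a metric\<close>.
\<close>

definition mem_up_to_isometry :: "'b metric \<Rightarrow> 'a metric set \<Rightarrow> bool" where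
  "mem_up_to_isometry V F \<longleftrightarrow> (\<exists>W\<in>F. isometric_metrics V W)"

definition closed_under_dilation :: "'a metric set \<Rightarrow> bool" where
  "closed_under_dilation F \<longleftrightarrow>
     (\<forall>U\<in>F. \<forall>s>0. mem_up_to_isometry (dilate_metric s U) F)"

definition closed_under_pythagorean_product :: "'a metric set \<Rightarrow> bool" where
  "closed_under_pythagorean_product F \<longleftrightarrow>
     (\<forall>U\<in>F. \<forall>V\<in>F. mem_up_to_isometry (prod_metric U V) F)"

definition quadratic_metric_inequality ::
    "real^'n^'n \<Rightarrow> real^'n^'n \<Rightarrow> 'a metric \<Rightarrow> bool" where
  "quadratic_metric_inequality A B X \<longleftrightarrow>
     (\<forall>x :: 'n \<Rightarrow> 'a. (\<forall>i. x i \<in> mspace X) \<longrightarrow>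
        (\<Sum>i\<in>UNIV. \<Sum>j\<in>UNIV. A $ i $ j * (mdist X (x i) (x j))\<^sup>2)
          \<le> (\<Sum>i\<in>UNIV. \<Sum>j\<in>UNIV. B $ i $ j * (mdist X (x i) (x j))\<^sup>2))"

text \<open>
  The distortion bound is extended real; at \<open>D = \<infinity>\<close> the convention \<open>\<infinity> * 0 = 0\<close> of \<open>ereal\<close> is
  harmless, as \<open>mdist X x y = 0\<close> only for \<open>x = y\<close>.
\<close>

definition distortion_at_most ::
    "'a metric \<Rightarrow> 'b metric \<Rightarrow> ('a \<Rightarrow> 'b) \<Rightarrow> ereal \<Rightarrow> bool" where
  "distortion_at_most X Y f D \<longleftrightarrow>
     (\<exists>s::real. s > 0 \<and>
        (\<forall>x\<in>mspace X. \<forall>y\<in>mspace X.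
           s * mdist X x y \<le> mdist Y (f x) (f y) \<and>
           ereal (mdist Y (f x) (f y)) \<le> D * ereal (s * mdist X x y)))"

text \<open>\<open>embedding_distortion Y X\<close> is \<open>c\<^sub>Y(X)\<close>.\<close>

definition embedding_distortion :: "'b metric \<Rightarrow> 'a metric \<Rightarrow> ereal" where
  "embedding_distortion Y X =
     Inf {D. 1 \<le> D \<and> (\<exists>f \<in> mspace X \<rightarrow> mspace Y. distortion_at_most X Y f D)}"

definition nonneg_entries :: "real^'n^'m \<Rightarrow> bool" where
  "nonneg_entries A \<longleftrightarrow> (\<forall>i j. 0 \<le> A $ i $ j)"

end

theory Submission
  imports Defs
begin

text \<open>
  Record a configuration of \<open>n\<close> points by its matrix of squared distances, and let \<open>C\<close> be the set of
  all such matrices coming from members of \<open>F\<close>. Squared distances add under Pythagorean products and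
  are multiplied by \<open>s\<^sup>2\<close> under dilation by \<open>s\<close>, so \<open>C\<close> is a convex cone
  (\<open>convex_cone_squared_distance_cone\<close>); its apex is the matrix of a constant configuration. In the
  inner product of matrices, \<open>F\<close> satisfies the \<open>(A,B)\<close>-inequality iff \<open>A \<bullet> M \<le> B \<bullet> M\<close> on \<open>C\<close>, that is,
  iff \<open>A - B\<close> lies in the polar cone of \<open>C\<close>.

  Let \<open>u\<close> be the matrix of an enumeration of \<open>X\<close>. After rescaling, an embedding of \<open>X\<close> into a member
  of \<open>F\<close> with distortion at most \<open>E\<close> is the same as a point of \<open>C\<close> in the order interval
  \<open>{u..E\<^sup>2 u}\<close>. Such a point \<open>M\<close> gives \<open>A \<bullet> u \<le> A \<bullet> M \<le> B \<bullet> M \<le> E\<^sup>2 (B \<bullet> u)\<close>; the necessity of the inequalities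
  follows as \<open>E\<close> decreases to \<open>D\<close>.

  For sufficiency, suppose that the closure of \<open>C\<close> misses the compact interval \<open>{u..D\<^sup>2 u}\<close>. A
  hyperplane with normal \<open>H\<close> separates the two, and the positive and negative parts of \<open>H\<close> are
  matrices \<open>A\<close>, \<open>B\<close> for which \<open>F\<close> satisfies the \<open>(A,B)\<close>-inequality while \<open>X\<close> violates the
  \<open>(A,D\<^sup>2 B)\<close>-inequality (\<open>closure_convex_cone_meets_interval\<close>). So the closure meets the interval.
  To replace the closure by \<open>C\<close> one enlarges \<open>D\<close> slightly
  (\<open>closure_squared_distance_cone_perturb\<close>), which an infimum of distortions permits.
\<close>

section \<open>The cone of squared distance matrices\<close>

definition squared_distances :: "'a metric \<Rightarrow> ('n::finite \<Rightarrow> 'a) \<Rightarrow> real^'n^'n" where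
  "squared_distances Z p = (\<chi> i j. (mdist Z (p i) (p j))\<^sup>2)"

definition squared_distance_cone :: "'a metric set \<Rightarrow> (real^'n::finite^'n) set" where
  "squared_distance_cone F = {squared_distances Z p | Z p. Z \<in> F \<and> range p \<subseteq> mspace Z}"

lemma squared_distances_nth [simp]:
  "squared_distances Z p $ i $ j = (mdist Z (p i) (p j))\<^sup>2"
  by (simp add: squared_distances_def)

lemma squared_distance_coneI:
  "\<lbrakk>Z \<in> F; range p \<subseteq> mspace Z\<rbrakk> \<Longrightarrow> squared_distances Z p \<in> squared_distance_cone F"
  unfolding squared_distance_cone_def by blast

lemma squared_distance_coneE:
  assumes "M \<in> squared_distance_cone F"
  obtains Z p where "Z \<in> F" "range p \<subseteq> mspace Z" "M = squared_distances Z p"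
  using assms unfolding squared_distance_cone_def by blast

lemma inner_matrix: "(A :: real^'n^'m) \<bullet> M = (\<Sum>i\<in>UNIV. \<Sum>j\<in>UNIV. A $ i $ j * M $ i $ j)"
  by (simp add: inner_vec_def)

lemma inner_mono_nonneg_entries:
  fixes A M N :: "real^'n^'n"
  assumes "nonneg_entries A" "M \<le> N"
  shows "A \<bullet> M \<le> A \<bullet> N"
  using assms unfolding inner_matrix nonneg_entries_def less_eq_vec_def
  by (intro sum_mono mult_left_mono) auto

lemma quadratic_metric_inequality_inner:
  "quadratic_metric_inequality A B Z \<longleftrightarrow>
     (\<forall>p. range p \<subseteq> mspace Z \<longrightarrow> A \<bullet> squared_distances Z p \<le> B \<bullet> squared_distances Z p)"
  by (simp add: quadratic_metric_inequality_def inner_matrix image_subset_iff)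

lemma family_quadratic_metric_inequality:
  "(\<forall>Z\<in>F. quadratic_metric_inequality A B Z) \<longleftrightarrow>
     (\<forall>M\<in>squared_distance_cone F. A \<bullet> M \<le> B \<bullet> M)"
  by (auto simp: quadratic_metric_inequality_inner squared_distance_cone_def)

text \<open>
  The closure conditions on \<open>F\<close> hold up to isometry only. Since a configuration can be carried along an
  isometry without changing its matrix, the cone does not see the difference.
\<close>

lemma squared_distance_cone_isometryI:
  assumes "mem_up_to_isometry W F" "range p \<subseteq> mspace W"
  shows "squared_distances W p \<in> squared_distance_cone F"
proof -
  obtain Z f where Z: "Z \<in> F" and f: "bij_betw f (mspace W) (mspace Z)"
    and iso: "\<forall>x\<in>mspace W. \<forall>y\<in>mspace W. mdist Z (f x) (f y) = mdist W x y"
    using assms(1) by (auto simp: mem_up_to_isometry_def isometric_metrics_def)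
  have "squared_distances W p = squared_distances Z (f \<circ> p)"
    using iso assms(2) by (simp add: vec_eq_iff image_subset_iff)
  moreover have "range (f \<circ> p) \<subseteq> mspace Z"
    using assms(2) bij_betw_imp_surj_on[OF f] by auto
  ultimately show ?thesis
    using Z by (simp add: squared_distance_coneI)
qed

lemma convex_cone_squared_distance_cone:
  assumes "F \<noteq> {}" "\<forall>U\<in>F. mspace U \<noteq> {}"
    and dil: "closed_under_dilation F" and prd: "closed_under_pythagorean_product F"
  shows "convex_cone (squared_distance_cone F :: (real^'n::finite^'n) set)"
  unfolding convex_cone_iff
proof (intro conjI ballI allI impI)
  let ?C = "squared_distance_cone F :: (real^'n^'n) set"
  obtain U a where U: "U \<in> F" "a \<in> mspace U"
    using assms(1,2) by blast
  then have "squared_distances U (\<lambda>_::'n. a) \<in> ?C"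
    by (intro squared_distance_coneI) auto
  moreover have "squared_distances U (\<lambda>_::'n. a) = 0"
    using U by (simp add: vec_eq_iff)
  ultimately show zero: "0 \<in> ?C" by simp
  show "M + N \<in> ?C" if "M \<in> ?C" "N \<in> ?C" for M N
  proof -
    from that obtain Z p Z' p' where Z: "Z \<in> F" "range p \<subseteq> mspace Z" "M = squared_distances Z p"
      and Z': "Z' \<in> F" "range p' \<subseteq> mspace Z'" "N = squared_distances Z' p'"
      by (elim squared_distance_coneE)
    have "M + N = squared_distances (prod_metric Z Z') (\<lambda>i. (p i, p' i))"
      using Z(3) Z'(3) by (simp add: vec_eq_iff mdist_prod_metric prod_dist_def)
    moreover have "mem_up_to_isometry (prod_metric Z Z') F"
      using prd Z(1) Z'(1) by (simp add: closed_under_pythagorean_product_def)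
    moreover have "range (\<lambda>i. (p i, p' i)) \<subseteq> mspace (prod_metric Z Z')"
      using Z(2) Z'(2) by auto
    ultimately show ?thesis
      by (simp add: squared_distance_cone_isometryI)
  qed
  show "t *\<^sub>R M \<in> ?C" if "M \<in> ?C" "0 \<le> t" for M t
  proof (cases "t = 0")
    case True
    then show ?thesis using zero by simp
  next
    case False
    with that have t: "0 < sqrt t" by simp
    from that(1) obtain Z p where Z: "Z \<in> F" "range p \<subseteq> mspace Z" "M = squared_distances Z p"
      by (rule squared_distance_coneE)
    \<comment> \<open>Dilating by the square root scales the squared distances by \<open>t\<close>.\<close>
    have "t *\<^sub>R M = squared_distances (dilate_metric (sqrt t) Z) p"
      using Z(3) t that(2) by (simp add: vec_eq_iff mdist_dilate_metric power_mult_distrib)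
    moreover have "mem_up_to_isometry (dilate_metric (sqrt t) Z) F"
      using dil Z(1) t by (simp only: closed_under_dilation_def)
    moreover have "range p \<subseteq> mspace (dilate_metric (sqrt t) Z)"
      using Z(2) t by (simp only: mspace_dilate_metric)
    ultimately show ?thesis
      by (simp add: squared_distance_cone_isometryI)
  qed
qed

section \<open>Separation from an order interval\<close>

text \<open>
  This is the duality step. For a matrix \<open>H\<close> with positive part \<open>A\<close> and negative part \<open>B\<close>, the minimum
  of \<open>H \<bullet> W\<close> over \<open>W \<in> {u..v}\<close> is \<open>A \<bullet> u - B \<bullet> v\<close>, attained at a corner \<open>W\<close> of the interval. A separating
  hyperplane makes this minimum positive while \<open>H\<close> is nonpositive on the cone.
\<close>

lemma closure_convex_cone_meets_interval:
  fixes C :: "(real^'n::finite^'n) set"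
  assumes C: "convex_cone C" and "u \<le> v"
    and ineq: "\<And>A B. \<lbrakk>nonneg_entries A; nonneg_entries B; \<forall>M\<in>C. A \<bullet> M \<le> B \<bullet> M\<rbrakk>
      \<Longrightarrow> A \<bullet> u \<le> B \<bullet> v"
  shows "closure C \<inter> {u..v} \<noteq> {}"
proof
  assume disj: "closure C \<inter> {u..v} = {}"
  have "\<exists>H b. (\<forall>M\<in>closure C. H \<bullet> M < b) \<and> (\<forall>M\<in>{u..v}. b < H \<bullet> M)"
  proof (rule separating_hyperplane_closed_compact)
    show "convex (closure C)"
      using C by (simp add: convex_cone_def convex_closure)
    show "convex {u..v}" "compact {u..v}"
      by (simp_all flip: cbox_interval)
  qed (use disj \<open>u \<le> v\<close> in auto)
  then obtain H b where H: "\<And>M. M \<in> C \<Longrightarrow> H \<bullet> M < b" "\<And>M. M \<in> {u..v} \<Longrightarrow> b < H \<bullet> M"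
    using closure_subset by blast
  have "0 < b"
    using H(1)[of 0] C by (simp add: convex_cone_iff)
  \<comment> \<open>A linear functional bounded above on a cone is nonpositive there: a positive value could be
    rescaled to \<open>b\<close>.\<close>
  have H_le: "H \<bullet> M \<le> 0" if "M \<in> C" for M
  proof (rule ccontr)
    assume "\<not> H \<bullet> M \<le> 0"
    then have "0 < H \<bullet> M" by simp
    moreover have "(b / (H \<bullet> M)) *\<^sub>R M \<in> C"
      using C that \<open>0 < b\<close> \<open>0 < H \<bullet> M\<close> by (simp add: convex_cone_iff)
    ultimately show False
      using H(1)[of "(b / (H \<bullet> M)) *\<^sub>R M"] by simp
  qed
  define A B :: "real^'n^'n"
    where "A = (\<chi> i j. max (H $ i $ j) 0)" and "B = (\<chi> i j. max (- (H $ i $ j)) 0)"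
  have AB: "A - B = H"
    by (auto simp: A_def B_def vec_eq_iff max_def)
  define W :: "real^'n^'n" where "W = (\<chi> i j. if 0 < H $ i $ j then u $ i $ j else v $ i $ j)"
  have "W \<in> {u..v}"
    using \<open>u \<le> v\<close> by (auto simp: W_def less_eq_vec_def)
  have "H \<bullet> W = A \<bullet> u - B \<bullet> v"
    unfolding inner_matrix sum_subtractf[symmetric]
    by (intro sum.cong refl) (auto simp: A_def B_def W_def)
  moreover have "A \<bullet> u \<le> B \<bullet> v"
  proof (rule ineq)
    show "\<forall>M\<in>C. A \<bullet> M \<le> B \<bullet> M"
      using H_le by (simp flip: AB add: inner_diff_left)
  qed (simp_all add: nonneg_entries_def A_def B_def)
  ultimately show False
    using H(2)[OF \<open>W \<in> {u..v}\<close>] \<open>0 < b\<close> by simp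
qed

text \<open>
  A matrix \<open>N\<close> in the cone close enough to \<open>M\<close> has off-diagonal entries with relative error at most
  \<open>\<delta>\<close> with respect to \<open>u\<close>, because those entries of \<open>u\<close> are bounded below by a positive \<open>\<mu>\<close>. On the
  diagonal \<open>u\<close> vanishes and no error can be absorbed; there \<open>N\<close> vanishes exactly, being a matrix of
  squared distances. Rescaling \<open>N\<close> by \<open>1 / (1 - \<delta>)\<close> restores the lower bound \<open>u\<close>.
\<close>

lemma closure_squared_distance_cone_perturb:
  fixes X :: "'b metric" and x :: "'n::finite \<Rightarrow> 'b"
  defines "u \<equiv> squared_distances X x"
  assumes C: "convex_cone (squared_distance_cone F :: (real^'n^'n) set)"
    and x: "inj x" "range x \<subseteq> mspace X"
    and M: "M \<in> closure (squared_distance_cone F)" "M \<in> {u..a *\<^sub>R u}"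
    and a: "1 \<le> a" "a < b"
  shows "squared_distance_cone F \<inter> {u..b *\<^sub>R u} \<noteq> {}"
proof -
  let ?P = "{(i, j). i \<noteq> j} :: ('n \<times> 'n) set"
  \<comment> \<open>The solution of \<open>a (1 + \<delta>) / (1 - \<delta>) = b\<close>, the upper bound after rescaling.\<close>
  define \<delta> where "\<delta> = (b - a) / (b + a)"
  have \<delta>: "0 < \<delta>" "\<delta> < 1" and \<delta>_eq: "a * (1 + \<delta>) = b * (1 - \<delta>)"
    using a by (auto simp: \<delta>_def field_simps)
  \<comment> \<open>The element 1 keeps the set nonempty when there is only one index.\<close>
  define \<mu> where "\<mu> = Min (insert 1 ((\<lambda>(i, j). u $ i $ j) ` ?P))"
  have pos: "0 < u $ i $ j" if "i \<noteq> j" for i j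
  proof -
    have "mdist X (x i) (x j) \<noteq> 0"
      using that x by (simp add: image_subset_iff inj_eq)
    then show ?thesis by (simp add: u_def)
  qed
  have "0 < \<mu>"
    unfolding \<mu>_def by (subst Min_gr_iff) (auto intro: pos)
  have \<mu>_le: "\<mu> \<le> u $ i $ j" if "i \<noteq> j" for i j
    unfolding \<mu>_def using that by (intro Min_le) auto
  obtain N where N: "N \<in> squared_distance_cone F" "dist N M < \<delta> * \<mu>"
    using M(1) \<delta>(1) \<open>0 < \<mu>\<close> by (meson closure_approachable mult_pos_pos)
  have bounds: "(1 - \<delta>) * u $ i $ j \<le> N $ i $ j \<and> N $ i $ j \<le> (1 - \<delta>) * (b * u $ i $ j)" for i j
  proof (cases "i = j")
    case True
    obtain Z p where "Z \<in> F" "range p \<subseteq> mspace Z" "N = squared_distances Z p"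
      using N(1) by (rule squared_distance_coneE)
    then have "p i \<in> mspace Z" "x i \<in> mspace X"
      using x(2) by auto
    then have "mdist Z (p i) (p i) = 0" "mdist X (x i) (x i) = 0"
      by simp_all
    then show ?thesis
      using True \<open>N = squared_distances Z p\<close> by (simp add: u_def)
  next
    case False
    have "\<bar>N $ i $ j - M $ i $ j\<bar> \<le> norm (N - M)"
      using Finite_Cartesian_Product.norm_nth_le[of "(N - M) $ i" j]
        Finite_Cartesian_Product.norm_nth_le[of "N - M" i] by simp
    also have "\<dots> \<le> \<delta> * \<mu>"
      using N(2) by (simp add: dist_norm)
    also have "\<dots> \<le> \<delta> * u $ i $ j"
      using \<mu>_le[OF False] \<delta>(1) by simp
    finally have near: "\<bar>N $ i $ j - M $ i $ j\<bar> \<le> \<delta> * u $ i $ j" .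
    have M': "u $ i $ j \<le> M $ i $ j" "M $ i $ j \<le> a * u $ i $ j"
      using M(2) by (auto simp: less_eq_vec_def)
    \<comment> \<open>As \<open>a \<ge> 1\<close>, an error relative to \<open>u\<close> is also one relative to the upper bound \<open>a u\<close>.\<close>
    have "\<delta> * u $ i $ j \<le> a * (\<delta> * u $ i $ j)"
      using a(1) \<delta>(1) pos[OF False] by simp
    then have "N $ i $ j \<le> a * (1 + \<delta>) * u $ i $ j"
      using near M'(2) by (simp add: algebra_simps)
    moreover have "(1 - \<delta>) * u $ i $ j \<le> N $ i $ j"
      using near M'(1) by (simp add: algebra_simps)
    ultimately show ?thesis
      by (simp add: \<delta>_eq mult_ac)
  qed
  have "inverse (1 - \<delta>) *\<^sub>R N \<in> squared_distance_cone F"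
    using C N(1) \<delta>(2) by (simp add: convex_cone_iff)
  moreover have "inverse (1 - \<delta>) *\<^sub>R N \<in> {u..b *\<^sub>R u}"
    using bounds \<delta>(2) by (auto simp: less_eq_vec_def field_simps)
  ultimately show ?thesis by blast
qed

section \<open>Distortion in terms of the cone\<close>

text \<open>
  Neither infimum, over maps or over members of \<open>F\<close>, need be attained, hence the quantification over
  \<open>D' > D\<close> on the right-hand side.
\<close>

lemma Inf_embedding_distortion_le_iff:
  assumes "1 \<le> D"
  shows "(INF Y\<in>F. embedding_distortion Y X) \<le> ereal D \<longleftrightarrow>
    (\<forall>D'>D. \<exists>Y\<in>F. \<exists>f\<in>mspace X \<rightarrow> mspace Y. distortion_at_most X Y f (ereal D'))"
proof
  assume le: "(INF Y\<in>F. embedding_distortion Y X) \<le> ereal D"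
  show "\<forall>D'>D. \<exists>Y\<in>F. \<exists>f\<in>mspace X \<rightarrow> mspace Y. distortion_at_most X Y f (ereal D')"
  proof (intro allI impI)
    fix D' assume "D < D'"
    with le have "(INF Y\<in>F. embedding_distortion Y X) < ereal D'"
      using le_less_trans by fastforce
    then obtain Y f E where Y: "Y \<in> F" "f \<in> mspace X \<rightarrow> mspace Y" "distortion_at_most X Y f E"
      and E: "E < ereal D'"
      by (auto simp: INF_less_iff embedding_distortion_def Inf_less_iff)
    obtain s where s: "s > 0" "\<And>x y. \<lbrakk>x \<in> mspace X; y \<in> mspace X\<rbrakk> \<Longrightarrow>
        s * mdist X x y \<le> mdist Y (f x) (f y) \<and> ereal (mdist Y (f x) (f y)) \<le> E * ereal (s * mdist X x y)"
      using Y(3) by (auto simp: distortion_at_most_def)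
    have "E * ereal (s * mdist X x y) \<le> ereal D' * ereal (s * mdist X x y)" for x y
      using E s(1) by (intro ereal_mult_right_mono) auto
    then have "distortion_at_most X Y f (ereal D')"
      unfolding distortion_at_most_def using s by (meson order_trans)
    then show "\<exists>Y\<in>F. \<exists>f\<in>mspace X \<rightarrow> mspace Y. distortion_at_most X Y f (ereal D')"
      using Y by blast
  qed
next
  assume R: "\<forall>D'>D. \<exists>Y\<in>F. \<exists>f\<in>mspace X \<rightarrow> mspace Y. distortion_at_most X Y f (ereal D')"
  show "(INF Y\<in>F. embedding_distortion Y X) \<le> ereal D"
  proof (rule ereal_le_epsilon2)
    fix e :: real assume "0 < e"
    then obtain Y f where Y: "Y \<in> F" "f \<in> mspace X \<rightarrow> mspace Y"
      "distortion_at_most X Y f (ereal (D + e))"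
      using R by (metis less_add_same_cancel1)
    have "embedding_distortion Y X \<le> ereal (D + e)"
      unfolding embedding_distortion_def
      using Y assms \<open>0 < e\<close> by (intro Inf_lower) auto
    then show "(INF Y\<in>F. embedding_distortion Y X) \<le> ereal D + ereal e"
      using Y(1) by (simp add: INF_lower2)
  qed
qed

text \<open>
  Dividing the matrix of the image configuration by \<open>s\<^sup>2\<close> normalizes the scaling factor \<open>s\<close> of the
  embedding to 1. The configuration may repeat points, as it may in a quadratic inequality for \<open>X\<close>.
\<close>

lemma squared_distance_cone_meets_interval_if_distortion:
  fixes X :: "'b metric" and x :: "'n::finite \<Rightarrow> 'b"
  defines "u \<equiv> squared_distances X x"
  assumes C: "convex_cone (squared_distance_cone F :: (real^'n^'n) set)"
    and Y: "Y \<in> F" and f: "f \<in> mspace X \<rightarrow> mspace Y" "distortion_at_most X Y f (ereal E)"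
    and x: "range x \<subseteq> mspace X"
  shows "squared_distance_cone F \<inter> {u..E\<^sup>2 *\<^sub>R u} \<noteq> {}"
proof -
  obtain s where "s > 0"
    and bounds: "\<And>y z. \<lbrakk>y \<in> mspace X; z \<in> mspace X\<rbrakk> \<Longrightarrow>
      s * mdist X y z \<le> mdist Y (f y) (f z) \<and> mdist Y (f y) (f z) \<le> E * (s * mdist X y z)"
    using f(2) by (auto simp: distortion_at_most_def)
  have xX: "x i \<in> mspace X" for i
    using x by auto
  define M where "M = squared_distances Y (f \<circ> x)"
  have "M \<in> squared_distance_cone F"
    unfolding M_def using Y f(1) xX by (intro squared_distance_coneI) auto
  then have "(1 / s\<^sup>2) *\<^sub>R M \<in> squared_distance_cone F"
    using C by (simp add: convex_cone_iff)
  moreover have "s\<^sup>2 * u $ i $ j \<le> M $ i $ j" "M $ i $ j \<le> s\<^sup>2 * (E\<^sup>2 * u $ i $ j)" for i j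
  proof -
    show "s\<^sup>2 * u $ i $ j \<le> M $ i $ j"
      using power_mono[of "s * mdist X (x i) (x j)" _ 2] bounds[OF xX xX, of i j] \<open>s > 0\<close>
      by (simp add: M_def u_def power_mult_distrib)
    have "(mdist Y (f (x i)) (f (x j)))\<^sup>2 \<le> (E * (s * mdist X (x i) (x j)))\<^sup>2"
      using bounds[OF xX xX, of i j] by (intro power_mono) auto
    then show "M $ i $ j \<le> s\<^sup>2 * (E\<^sup>2 * u $ i $ j)"
      by (simp add: M_def u_def power_mult_distrib mult.left_commute)
  qed
  then have "(1 / s\<^sup>2) *\<^sub>R M \<in> {u..E\<^sup>2 *\<^sub>R u}"
    using \<open>s > 0\<close> by (simp add: less_eq_vec_def field_simps)
  ultimately show ?thesis by blast
qed

text \<open>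
  Conversely, if \<open>x\<close> enumerates \<open>X\<close>, a configuration \<open>p\<close> with matrix in the interval defines the
  embedding \<open>x i \<mapsto> p i\<close>, with scaling factor 1.
\<close>

lemma distortion_if_squared_distance_cone_meets_interval:
  fixes X :: "'b metric" and x :: "'n::finite \<Rightarrow> 'b"
  defines "u \<equiv> squared_distances X x"
  assumes x: "bij_betw x UNIV (mspace X)" and "0 \<le> E"
    and meets: "squared_distance_cone F \<inter> {u..E\<^sup>2 *\<^sub>R u} \<noteq> {}"
  shows "\<exists>Y\<in>F. \<exists>f\<in>mspace X \<rightarrow> mspace Y. distortion_at_most X Y f (ereal E)"
proof -
  obtain M where M: "M \<in> squared_distance_cone F" "M \<in> {u..E\<^sup>2 *\<^sub>R u}"
    using meets by blast
  from M(1) obtain Y p where Y: "Y \<in> F" "range p \<subseteq> mspace Y" "M = squared_distances Y p"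
    by (rule squared_distance_coneE)
  have bounds: "mdist X (x i) (x j) \<le> mdist Y (p i) (p j)"
    "mdist Y (p i) (p j) \<le> E * mdist X (x i) (x j)" for i j
  proof -
    have "(mdist X (x i) (x j))\<^sup>2 \<le> (mdist Y (p i) (p j))\<^sup>2"
      "(mdist Y (p i) (p j))\<^sup>2 \<le> (E * mdist X (x i) (x j))\<^sup>2"
      using M(2) by (auto simp: Y(3) u_def less_eq_vec_def power_mult_distrib)
    then show "mdist X (x i) (x j) \<le> mdist Y (p i) (p j)"
      "mdist Y (p i) (p j) \<le> E * mdist X (x i) (x j)"
      using \<open>0 \<le> E\<close> by (auto intro: power2_le_imp_le)
  qed
  define g where "g = inv_into UNIV x"
  have g: "x (g y) = y" if "y \<in> mspace X" for y
    using that x by (simp add: g_def bij_betw_inv_into_right)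
  have "distortion_at_most X Y (p \<circ> g) (ereal E)"
    unfolding distortion_at_most_def
  proof (intro exI[of _ 1] conjI ballI)
    fix y z assume "y \<in> mspace X" "z \<in> mspace X"
    then show "1 * mdist X y z \<le> mdist Y ((p \<circ> g) y) ((p \<circ> g) z)"
      "ereal (mdist Y ((p \<circ> g) y) ((p \<circ> g) z)) \<le> ereal E * ereal (1 * mdist X y z)"
      using bounds[of "g y" "g z"] g by auto
  qed simp
  moreover have "p \<circ> g \<in> mspace X \<rightarrow> mspace Y"
    using Y(2) by auto
  ultimately show ?thesis
    using Y(1) by blast
qed

section \<open>The duality theorem\<close>

theorem proposition3:
  fixes F :: "'a metric set" and X :: "'b metric" and D :: real
  assumes "F \<noteq> {}"
    and "\<forall>U\<in>F. mspace U \<noteq> {}"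
    and "closed_under_dilation F"
    and "closed_under_pythagorean_product F"
    and "1 \<le> D"
    and "finite (mspace X)" and "card (mspace X) = CARD('n::finite)"
  shows "(INF Y\<in>F. embedding_distortion Y X) \<le> ereal D \<longleftrightarrow>
    (\<forall>A B :: real^'n^'n.
       nonneg_entries A \<longrightarrow> nonneg_entries B \<longrightarrow>
       (\<forall>Z\<in>F. quadratic_metric_inequality A B Z) \<longrightarrow>
       quadratic_metric_inequality A (D\<^sup>2 *\<^sub>R B) X)"
proof -
  let ?C = "squared_distance_cone F :: (real^'n^'n) set"
  have C: "convex_cone ?C"
    using assms(1-4) by (rule convex_cone_squared_distance_cone)
  show ?thesis
    unfolding Inf_embedding_distortion_le_iff[OF \<open>1 \<le> D\<close>] family_quadratic_metric_inequality
  proof (intro iffI allI impI)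
    fix A B :: "real^'n^'n"
    assume embeds: "\<forall>D'>D. \<exists>Y\<in>F. \<exists>f\<in>mspace X \<rightarrow> mspace Y. distortion_at_most X Y f (ereal D')"
      and A: "nonneg_entries A" and B: "nonneg_entries B" and AB: "\<forall>M\<in>?C. A \<bullet> M \<le> B \<bullet> M"
    show "quadratic_metric_inequality A (D\<^sup>2 *\<^sub>R B) X"
      unfolding quadratic_metric_inequality_inner
    proof (intro allI impI)
      fix x :: "'n \<Rightarrow> 'b" assume x: "range x \<subseteq> mspace X"
      define u where "u = squared_distances X x"
      have le: "A \<bullet> u \<le> D'\<^sup>2 * (B \<bullet> u)" if D': "D < D'" for D'
      proof -
        obtain Y f where "Y \<in> F" "f \<in> mspace X \<rightarrow> mspace Y" "distortion_at_most X Y f (ereal D')"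
          using embeds D' by blast
        then have "?C \<inter> {u..D'\<^sup>2 *\<^sub>R u} \<noteq> {}"
          unfolding u_def using C x by (intro squared_distance_cone_meets_interval_if_distortion)
        then obtain M where M: "M \<in> ?C" "u \<le> M" "M \<le> D'\<^sup>2 *\<^sub>R u"
          by auto
        have "A \<bullet> u \<le> A \<bullet> M"
          using A M(2) by (rule inner_mono_nonneg_entries)
        also have "\<dots> \<le> B \<bullet> M"
          using AB M(1) by blast
        also have "\<dots> \<le> B \<bullet> (D'\<^sup>2 *\<^sub>R u)"
          using B M(3) by (rule inner_mono_nonneg_entries)
        finally show ?thesis by simp
      qed
      have "((\<lambda>D'. D'\<^sup>2 * (B \<bullet> u)) \<longlongrightarrow> D\<^sup>2 * (B \<bullet> u)) (at_right D)"
        by (intro tendsto_intros)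
      moreover have "\<forall>\<^sub>F D' in at_right D. A \<bullet> u \<le> D'\<^sup>2 * (B \<bullet> u)"
        using eventually_at_right_less[of D] by (rule eventually_mono) (rule le)
      ultimately have "A \<bullet> u \<le> D\<^sup>2 * (B \<bullet> u)"
        by (rule tendsto_lowerbound) simp
      then show "A \<bullet> squared_distances X x \<le> (D\<^sup>2 *\<^sub>R B) \<bullet> squared_distances X x"
        by (simp add: u_def)
    qed
  next
    fix D' assume ineq: "\<forall>A B :: real^'n^'n. nonneg_entries A \<longrightarrow> nonneg_entries B \<longrightarrow>
      (\<forall>M\<in>?C. A \<bullet> M \<le> B \<bullet> M) \<longrightarrow> quadratic_metric_inequality A (D\<^sup>2 *\<^sub>R B) X" and "D < D'"
    obtain x :: "'n \<Rightarrow> 'b" where x: "bij_betw x UNIV (mspace X)"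
      using finite_same_card_bij[of "UNIV :: 'n set" "mspace X"] assms(6,7) by auto
    then have x': "inj x" "range x \<subseteq> mspace X"
      by (auto simp: bij_betw_def)
    define u where "u = squared_distances X x"
    have D: "1 \<le> D\<^sup>2" "D\<^sup>2 < D'\<^sup>2"
      using \<open>1 \<le> D\<close> \<open>D < D'\<close> by (auto simp: power_strict_mono)
    have "1 * (mdist X y z)\<^sup>2 \<le> D\<^sup>2 * (mdist X y z)\<^sup>2" for y z
      using D(1) by (intro mult_right_mono) auto
    then have "u \<le> D\<^sup>2 *\<^sub>R u"
      by (simp add: u_def less_eq_vec_def)
    with C have "closure ?C \<inter> {u..D\<^sup>2 *\<^sub>R u} \<noteq> {}"
    proof (rule closure_convex_cone_meets_interval)
      fix A B :: "real^'n^'n"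
      assume "nonneg_entries A" "nonneg_entries B" "\<forall>M\<in>?C. A \<bullet> M \<le> B \<bullet> M"
      then have "quadratic_metric_inequality A (D\<^sup>2 *\<^sub>R B) X"
        using ineq by blast
      then show "A \<bullet> u \<le> B \<bullet> (D\<^sup>2 *\<^sub>R u)"
        using x'(2) by (simp add: quadratic_metric_inequality_inner u_def)
    qed
    then have "?C \<inter> {u..D'\<^sup>2 *\<^sub>R u} \<noteq> {}"
      using closure_squared_distance_cone_perturb[OF C x'] D unfolding u_def by blast
    then show "\<exists>Y\<in>F. \<exists>f\<in>mspace X \<rightarrow> mspace Y. distortion_at_most X Y f (ereal D')"
      using x \<open>1 \<le> D\<close> \<open>D < D'\<close> unfolding u_def
      by (intro distortion_if_squared_distance_cone_meets_interval) auto
  qed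
qed

end
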